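(* Let $X$ be a Banach space and let $C\subset X$ be a nonempty closed convex bounded set. Then $C$ is weakly compact if and only if $C$ has the $\mathcal{G}$-FPP for affine bi-Lipschitz maps, that is, if and only if for every nonempty closed convex (bounded) subset $K\subset C$, every affine bi-Lipschitz map $f\colon K\to K$ has a fixed point.
   Context: For a convex subset $M$ of a Banach space, $\mathcal{B}(M)$ denotes the family of all nonempty, bounded, closed convex subsets of $M$. A set $C\in\mathcal{B}(X)$ has the $\mathcal{G}$-FPP (generic fixed point property) for a class $\mathcal{M}$ of mappings if for every $K\in\mathcal{B}(C)$, every mapping $f\in\mathcal{M}$ with $f(K)\subset K$ has a fixed point in $K$. A map $f\colon K\to K$ is affine if $f(tx+(1-t)y)=tf(x)+(1-t)f(y)$ for all $x,y\in K$ and $t\in[0,1]$. It is bi-Lipschitz if there are constants $a,b>0$ with $a\|x-y\|\le\|f(x)-f(y)\|\le b\|x-y\|$ for all $x,y\in K$ (surjectivity is not required). *)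

theory Defs
  imports "HOL-Analysis.Analysis"
begin

text \<open>The weak topology: the coarsest topology making every continuous linear functional
  continuous.\<close>

definition weak_topology :: "'a::real_normed_vector topology" where
  "weak_topology =
    topology_generated_by {f -` U | (f :: 'a \<Rightarrow> real) U. bounded_linear f \<and> open U}"

definition weakly_compact :: "'a::real_normed_vector set \<Rightarrow> bool" where
  "weakly_compact C \<longleftrightarrow> compactin weak_topology C"

text \<open>The family $\mathcal{B}(M)$. Closedness is taken in the whole space; for closed \<open>M\<close> this
  agrees with closedness relative to \<open>M\<close>.\<close>

definition bounded_closed_convex_subsets :: "'a::real_normed_vector set \<Rightarrow> 'a set set" where
  "bounded_closed_convex_subsets M =
    {K. K \<subseteq> M \<and> K \<noteq> {} \<and> bounded K \<and> closed K \<and> convex K}"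

text \<open>A map with domain \<open>K\<close> is represented by a total function of which only the values on \<open>K\<close>
  matter; accordingly, a class of mappings is a predicate on pairs of a domain and a function.\<close>

definition generic_fpp ::
    "('a::real_normed_vector set \<Rightarrow> ('a \<Rightarrow> 'a) \<Rightarrow> bool) \<Rightarrow> 'a set \<Rightarrow> bool" where
  "generic_fpp \<M> C \<longleftrightarrow>
    (\<forall>K \<in> bounded_closed_convex_subsets C. \<forall>f. \<M> K f \<and> f ` K \<subseteq> K \<longrightarrow> (\<exists>x\<in>K. f x = x))"

definition affine_map_on :: "'a::real_vector set \<Rightarrow> ('a \<Rightarrow> 'b::real_vector) \<Rightarrow> bool" where
  "affine_map_on K f \<longleftrightarrow>
    (\<forall>x\<in>K. \<forall>y\<in>K. \<forall>t\<in>{0..1::real}.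
      f (t *\<^sub>R x + (1 - t) *\<^sub>R y) = t *\<^sub>R f x + (1 - t) *\<^sub>R f y)"

definition bi_lipschitz_on ::
    "'a::real_normed_vector set \<Rightarrow> ('a \<Rightarrow> 'b::real_normed_vector) \<Rightarrow> bool" where
  "bi_lipschitz_on K f \<longleftrightarrow>
    (\<exists>a>0. \<exists>b>0. \<forall>x\<in>K. \<forall>y\<in>K.
      a * norm (x - y) \<le> norm (f x - f y) \<and> norm (f x - f y) \<le> b * norm (x - y))"

end

theory Submission
  imports Defs
begin

text \<open>For weakly compact \<open>C\<close> an affine Lipschitz self-map \<open>f\<close> of \<open>K\<close> has approximate fixed points, because
  the averages of an orbit are almost fixed. The sets of \<open>e\<close>-almost fixed points are closed and
  convex by affinity, hence weakly closed, and weak compactness makes them meet in a fixed point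
  (\<open>weakly_compact_fixed_point\<close>).

  Conversely, let \<open>C\<close> fail to be weakly compact. Embed \<open>C\<close> into the bidual by evaluation. By
  Tychonoff's theorem its weak-star closure is compact, so it must contain a functional \<open>F\<close> on the
  dual that is not the evaluation at a point of \<open>C\<close>, nor at any other point, as \<open>C\<close> is closed and
  convex, and \<open>F\<close> then has positive distance from the
  evaluations because the space is complete. As in James's characterisation of weak compactness,
  one alternately picks functionals that vanish on the points found so far while \<open>F\<close> maps them to 1,
  and points of \<open>C\<close> at which the functionals found so far almost take the values given by \<open>F\<close>.
  The resulting points \<open>x k\<close> satisfy
  \<open>\<bar>\<Sum>k\<in>{m..<N}. a k\<bar> \<le> const * norm (\<Sum>k<N. a k *\<^sub>R x k)\<close> (\<open>tail_sums_bounded\<close>), and the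
  Hahn-Banach theorem turns this estimate into functionals \<open>G m\<close>, bounded uniformly in \<open>m\<close>, with
  \<open>G m (x k) = 1\<close> for \<open>m \<le> k\<close> and \<open>G m (x k) = 0\<close> for \<open>k < m\<close> (\<open>exists_summing_system\<close>).

  The differences \<open>G n - G (Suc n)\<close> are the coordinate functionals of \<open>x\<close>. On the closed convex
  hull \<open>K\<close> of the points \<open>x k\<close> consider
  \<open>f z = z + (\<Sum>n. c * (1/2) ^ n * (G n z - G (Suc n) z) *\<^sub>R (x (Suc n) - x n))\<close>,
  which moves a small fraction of the mass at \<open>x n\<close> to \<open>x (Suc n)\<close>. It is linear, and it is
  bi-Lipschitz because for small \<open>c\<close> it is a perturbation of the identity by an operator of norm
  less than 1. A fixed point in \<open>K\<close> would have all coordinates 0, so every \<open>G m\<close> would take at it the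
  same value as \<open>G 0\<close>, which is 1 on \<open>K\<close>; but \<open>G m\<close> tends to 0 pointwise on \<open>K\<close>.

  Every use of the Hahn-Banach theorem is an instance of one statement: a functional of norm at
  most \<open>M\<close> can be found above prescribed lower bounds \<open>b\<close> at vectors \<open>a\<close>, if the pairs \<open>(a, b)\<close> form
  a convex cone on which \<open>b \<le> M * norm a\<close> (\<open>bounded_functional_above_cone\<close>).\<close>

section \<open>The Hahn-Banach theorem for convex cones\<close>

definition sublinear :: "('a::real_vector \<Rightarrow> real) \<Rightarrow> bool" where
  "sublinear p \<longleftrightarrow>
    (\<forall>x y. p (x + y) \<le> p x + p y) \<and> (\<forall>c>0. \<forall>x. p (c *\<^sub>R x) \<le> c * p x)"

lemma sublinearI:
  assumes "\<And>x y. p (x + y) \<le> p x + p y" and "\<And>c x. c > 0 \<Longrightarrow> p (c *\<^sub>R x) \<le> c * p x"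
  shows "sublinear p"
  using assms by (simp add: sublinear_def)

lemma sublinear_add: "sublinear p \<Longrightarrow> p (x + y) \<le> p x + p y"
  by (simp add: sublinear_def)

lemma sublinear_scaleR_pos:
  assumes "sublinear p" and "c > 0"
  shows "p (c *\<^sub>R x) = c * p x"
proof (rule antisym)
  show "p (c *\<^sub>R x) \<le> c * p x"
    using assms by (simp add: sublinear_def)
  have "p (inverse c *\<^sub>R (c *\<^sub>R x)) \<le> inverse c * p (c *\<^sub>R x)"
    using assms positive_imp_inverse_positive unfolding sublinear_def by blast
  then show "c * p x \<le> p (c *\<^sub>R x)"
    using \<open>c > 0\<close> by (simp add: field_simps)
qed

lemma sublinear_zero: "sublinear p \<Longrightarrow> p 0 = 0"
  using sublinear_scaleR_pos[of p 2 0] by simp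

lemma sublinear_ge: "sublinear p \<Longrightarrow> - p (- x) \<le> p x"
  using sublinear_add[of p x "- x"] by (simp add: sublinear_zero)

lemma sublinear_norm:
  assumes "M \<ge> 0"
  shows "sublinear (\<lambda>x. M * norm x)"
  by (rule sublinearI) (use assms in \<open>auto simp: norm_triangle_ineq mult_left_mono
        simp flip: distrib_left\<close>)

text \<open>If a linear functional \<open>f \<le> p\<close> satisfies \<open>b \<le> f a\<close> for all \<open>(a, b) \<in> A\<close>, then
  \<open>f v = f (v + a) - f a \<le> p (v + a) - b\<close>. The function below is thus the best upper bound for
  such \<open>f\<close>.\<close>

definition cone_infimum :: "('a::real_vector \<Rightarrow> real) \<Rightarrow> ('a \<times> real) set \<Rightarrow> 'a \<Rightarrow> real" where
  "cone_infimum p A v = (INF (a, b)\<in>A. p (v + a) - b)"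

text \<open>The infimum is finite because \<open>b \<le> p a \<le> p (v + a) + p (- v)\<close>; it inherits sublinearity from \<open>p\<close>
  since pairs of \<open>A\<close> may be added and scaled. The last claim is what converts a bound from above on
  linear functionals into the lower bound \<open>b\<close> at \<open>a\<close>.\<close>

lemma
  fixes p :: "'a::real_vector \<Rightarrow> real"
  assumes p: "sublinear p" and A: "convex_cone A"
    and le: "\<And>a b. (a, b) \<in> A \<Longrightarrow> b \<le> p a"
  shows sublinear_cone_infimum: "sublinear (cone_infimum p A)"
    and cone_infimum_le: "cone_infimum p A v \<le> p v"
    and cone_infimum_uminus_le: "(a, b) \<in> A \<Longrightarrow> cone_infimum p A (- a) \<le> - b"
proof -
  let ?q = "cone_infimum p A"
  have bdd: "bdd_below ((\<lambda>(a, b). p (v + a) - b) ` A)" for v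
  proof (rule bdd_belowI2)
    fix ab assume "ab \<in> A"
    moreover obtain a b where ab: "ab = (a, b)" by fastforce
    ultimately have "b \<le> p a" using le by blast
    also have "p a \<le> p (v + a) + p (- v)"
      using sublinear_add[OF p, of "v + a" "- v"] by simp
    finally show "- p (- v) \<le> (case ab of (a, b) \<Rightarrow> p (v + a) - b)"
      by (simp add: ab)
  qed
  have lower: "?q v \<le> p (v + a) - b" if "(a, b) \<in> A" for v a b
    unfolding cone_infimum_def using cINF_lower[OF bdd that] by simp
  have greatest: "m \<le> ?q v" if "\<And>a b. (a, b) \<in> A \<Longrightarrow> m \<le> p (v + a) - b" for m v
    unfolding cone_infimum_def
    by (rule cINF_greatest) (use that convex_cone_nonempty[OF A] in auto)
  show "?q v \<le> p v"
    using lower[of 0 0 v] convex_cone_contains_0[OF A] by (simp add: zero_prod_def)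
  show "?q (- a) \<le> - b" if "(a, b) \<in> A"
    using lower[OF that, of "- a"] by (simp add: sublinear_zero[OF p])
  show "sublinear ?q"
  proof (rule sublinearI)
    fix v w
    have "?q (v + w) - ?q w \<le> p (v + a) - b" if ab: "(a, b) \<in> A" for a b
    proof -
      have "?q (v + w) - (p (v + a) - b) \<le> p (w + a') - b'" if ab': "(a', b') \<in> A" for a' b'
      proof -
        have "?q (v + w) \<le> p ((v + w) + (a + a')) - (b + b')"
          using convex_cone_add[OF A ab ab'] by (intro lower) simp
        also have "(v + w) + (a + a') = (v + a) + (w + a')" by simp
        also have "p \<dots> \<le> p (v + a) + p (w + a')" by (rule sublinear_add[OF p])
        finally show ?thesis by simp
      qed
      then have "?q (v + w) - (p (v + a) - b) \<le> ?q w" by (rule greatest)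
      then show ?thesis by simp
    qed
    then have "?q (v + w) - ?q w \<le> ?q v" by (rule greatest)
    then show "?q (v + w) \<le> ?q v + ?q w" by simp
  next
    fix c :: real and v assume c: "c > 0"
    have "?q (c *\<^sub>R v) / c \<le> p (v + a) - b" if "(a, b) \<in> A" for a b
    proof -
      have "?q (c *\<^sub>R v) \<le> p (c *\<^sub>R v + c *\<^sub>R a) - c * b"
        using convex_cone_scaleR[OF A _ that, of c] c by (intro lower) simp
      also have "\<dots> = c * (p (v + a) - b)"
        using sublinear_scaleR_pos[OF p c, of "v + a"] by (simp add: algebra_simps)
      finally show ?thesis using c by (simp add: field_simps)
    qed
    then have "?q (c *\<^sub>R v) / c \<le> ?q v" by (rule greatest)
    then show "?q (c *\<^sub>R v) \<le> c * ?q v" using c by (simp add: field_simps)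
  qed
qed

text \<open>By Zorn's lemma: sublinear functions below \<open>p\<close> are bounded below by \<open>- p (- x)\<close>, so a chain of
  them has a finite pointwise infimum, and comparability makes that infimum subadditive.\<close>

lemma exists_minimal_sublinear:
  fixes p :: "'a::real_vector \<Rightarrow> real"
  assumes p: "sublinear p"
  obtains q where "sublinear q" and "\<And>x. q x \<le> p x"
    and "\<And>r x. sublinear r \<Longrightarrow> (\<And>x. r x \<le> q x) \<Longrightarrow> r x = q x"
proof -
  define S where "S = {q. sublinear q \<and> q \<le> p}"
  have po: "partial_order_on S (relation_of (\<ge>) S)"
    by (rule partial_order_on_relation_ofI) auto
  have "\<exists>u\<in>S. \<forall>a\<in>\<C>. u \<le> a" if "\<C> \<in> Chains (relation_of (\<ge>) S)" for \<C>
  proof (cases "\<C> = {}")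
    case True
    then show ?thesis using p by (auto simp: S_def)
  next
    case False
    from that have sub: "\<C> \<subseteq> S" and chain: "\<And>a b. a \<in> \<C> \<Longrightarrow> b \<in> \<C> \<Longrightarrow> a \<le> b \<or> b \<le> a"
      by (auto simp: Chains_def relation_of_def)
    define u where "u x = (INF a\<in>\<C>. a x)" for x
    have bdd: "bdd_below ((\<lambda>a. a x) ` \<C>)" for x
    proof (rule bdd_belowI2)
      fix a assume "a \<in> \<C>"
      then have "sublinear a" "a (- x) \<le> p (- x)"
        using sub by (auto simp: S_def le_fun_def)
      then show "- p (- x) \<le> a x" using sublinear_ge[of a x] by linarith
    qed
    have lower: "u x \<le> a x" if "a \<in> \<C>" for a x
      unfolding u_def by (rule cINF_lower[OF bdd that])
    have greatest: "m \<le> u x" if "\<And>a. a \<in> \<C> \<Longrightarrow> m \<le> a x" for m x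
      unfolding u_def by (rule cINF_greatest) (use that False in auto)
    have "sublinear u"
    proof (rule sublinearI)
      fix x y
      have "u (x + y) - u y \<le> a x" if a: "a \<in> \<C>" for a
      proof -
        have "u (x + y) - a x \<le> b y" if b: "b \<in> \<C>" for b
        proof -
          obtain c where c: "c \<in> \<C>" "c \<le> a" "c \<le> b"
            using chain[OF a b] a b by blast
          have "u (x + y) \<le> c (x + y)" by (rule lower[OF c(1)])
          also have "\<dots> \<le> c x + c y"
            using c(1) sub by (intro sublinear_add) (auto simp: S_def)
          also have "\<dots> \<le> a x + b y"
            using c(2,3) by (simp add: add_mono le_fun_def)
          finally show ?thesis by simp
        qed
        then have "u (x + y) - a x \<le> u y" by (rule greatest)
        then show ?thesis by simp
      qed
      then have "u (x + y) - u y \<le> u x" by (rule greatest)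
      then show "u (x + y) \<le> u x + u y" by simp
    next
      fix c :: real and x assume c: "c > 0"
      have "u (c *\<^sub>R x) / c \<le> a x" if a: "a \<in> \<C>" for a
      proof -
        have "a (c *\<^sub>R x) = c * a x"
          using a sub c by (intro sublinear_scaleR_pos) (auto simp: S_def)
        then show ?thesis using lower[OF a, of "c *\<^sub>R x"] c by (simp add: field_simps)
      qed
      then have "u (c *\<^sub>R x) / c \<le> u x" by (rule greatest)
      then show "u (c *\<^sub>R x) \<le> c * u x" using c by (simp add: field_simps)
    qed
    moreover have "u \<le> p"
    proof -
      obtain a where a: "a \<in> \<C>" using False by blast
      then have "a \<le> p" using sub by (auto simp: S_def)
      then show ?thesis using lower[OF a] by (auto simp: le_fun_def intro: order_trans)
    qed
    ultimately show ?thesis using lower by (auto simp: S_def le_fun_def)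
  qed
  then obtain q where q: "q \<in> S" and min: "\<And>r. r \<in> S \<Longrightarrow> r \<le> q \<Longrightarrow> r = q"
    using predicate_Zorn[OF po] by blast
  show thesis
  proof (rule that)
    show "sublinear q" "\<And>x. q x \<le> p x" using q by (auto simp: S_def le_fun_def)
    fix r x assume "sublinear r" "\<And>x. r x \<le> q x"
    then have "r \<in> S" "r \<le> q" using q by (auto simp: S_def le_fun_def intro: order_trans)
    then show "r x = q x" using min by blast
  qed
qed

lemma sublinear_imp_linear:
  assumes q: "sublinear q" and odd: "\<And>x. q (- x) \<le> - q x"
  shows "linear q"
proof -
  have minus: "q (- x) = - q x" for x
    using odd[of x] sublinear_ge[OF q, of x] by linarith
  show ?thesis
  proof (rule linearI)
    fix x y
    have "- q (x + y) \<le> - q x + - q y"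
      using sublinear_add[OF q, of "- x" "- y"] minus[of "x + y"] by (simp add: minus)
    then show "q (x + y) = q x + q y"
      using sublinear_add[OF q, of x y] by linarith
  next
    fix c :: real and x
    consider "c > 0" | "c = 0" | "- c > 0" by linarith
    then show "q (c *\<^sub>R x) = c *\<^sub>R q x"
    proof cases
      case 3
      have "q (c *\<^sub>R x) = - q ((- c) *\<^sub>R x)" by (simp add: minus)
      also have "\<dots> = c * q x" using sublinear_scaleR_pos[OF q 3, of x] by simp
      finally show ?thesis by simp
    qed (simp_all add: sublinear_scaleR_pos[OF q] sublinear_zero[OF q])
  qed
qed

text \<open>A minimal sublinear function \<open>q\<close> below \<open>cone_infimum p A\<close> is linear. Indeed, lowering \<open>q\<close> further
  along the ray of pairs \<open>(t *\<^sub>R x, t * q x)\<close> with \<open>t \<ge> 0\<close> gives a sublinear function below \<open>q\<close> whose value at \<open>- x\<close>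
  is at most \<open>- q x\<close>; by minimality this already holds for \<open>q\<close>.\<close>

theorem Hahn_Banach_cone:
  fixes p :: "'a::real_vector \<Rightarrow> real"
  assumes p: "sublinear p" and A: "convex_cone A"
    and le: "\<And>a b. (a, b) \<in> A \<Longrightarrow> b \<le> p a"
  obtains f where "linear f" and "\<And>x. f x \<le> p x" and "\<And>a b. (a, b) \<in> A \<Longrightarrow> b \<le> f a"
proof -
  obtain q where q: "sublinear q" and q_le: "\<And>x. q x \<le> cone_infimum p A x"
    and min: "\<And>r x. sublinear r \<Longrightarrow> (\<And>x. r x \<le> q x) \<Longrightarrow> r x = q x"
    using exists_minimal_sublinear[OF sublinear_cone_infimum[OF p A le]] by blast
  have "q (- x) \<le> - q x" for x
  proof -
    define R where "R = {(t *\<^sub>R x, t * q x) | t. t \<ge> 0}"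
    have R: "convex_cone R"
      unfolding convex_cone_iff
    proof (intro conjI ballI allI impI)
      show "0 \<in> R" unfolding R_def by (force simp: zero_prod_def)
    next
      fix u v assume "u \<in> R" "v \<in> R"
      then obtain s t where "s \<ge> 0" "t \<ge> 0" "u = (s *\<^sub>R x, s * q x)" "v = (t *\<^sub>R x, t * q x)"
        by (auto simp: R_def)
      then have "u + v = ((s + t) *\<^sub>R x, (s + t) * q x) \<and> s + t \<ge> 0" by (simp add: algebra_simps)
      then show "u + v \<in> R" unfolding R_def by blast
    next
      fix u and c :: real assume "u \<in> R" "c \<ge> 0"
      then obtain s where "s \<ge> 0" "u = (s *\<^sub>R x, s * q x)" by (auto simp: R_def)
      then have "c *\<^sub>R u = ((c * s) *\<^sub>R x, (c * s) * q x) \<and> c * s \<ge> 0" using \<open>c \<ge> 0\<close> by simp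
      then show "c *\<^sub>R u \<in> R" unfolding R_def by blast
    qed
    have R_le: "b \<le> q a" if "(a, b) \<in> R" for a b
    proof -
      from that obtain t where "t \<ge> 0" "a = t *\<^sub>R x" "b = t * q x" by (auto simp: R_def)
      then show ?thesis
        by (cases "t = 0") (simp_all add: sublinear_scaleR_pos[OF q] sublinear_zero[OF q])
    qed
    have "q (- x) = cone_infimum q R (- x)"
      using min[OF sublinear_cone_infimum[OF q R R_le], of "- x"] cone_infimum_le[OF q R R_le]
      by simp
    also have "\<dots> \<le> - q x"
      by (rule cone_infimum_uminus_le[OF q R R_le]) (auto simp: R_def intro!: exI[of _ 1])
    finally show ?thesis .
  qed
  then have lin: "linear q" by (rule sublinear_imp_linear[OF q])
  show thesis
  proof (rule that[OF lin])
    show "q x \<le> p x" for x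
      using q_le cone_infimum_le[OF p A le] order_trans by blast
    show "b \<le> q a" if "(a, b) \<in> A" for a b
      using order_trans[OF q_le cone_infimum_uminus_le[OF p A le that]]
      by (simp add: linear_neg[OF lin])
  qed
qed

corollary bounded_functional_above_cone:
  fixes A :: "('a::real_normed_vector \<times> real) set"
  assumes "M \<ge> 0" and "convex_cone A" and "\<And>a b. (a, b) \<in> A \<Longrightarrow> b \<le> M * norm a"
  obtains f :: "'a \<Rightarrow>\<^sub>L real" where "norm f \<le> M" and "\<And>a b. (a, b) \<in> A \<Longrightarrow> b \<le> f a"
proof -
  obtain f where f: "linear f" "\<And>x. f x \<le> M * norm x" "\<And>a b. (a, b) \<in> A \<Longrightarrow> b \<le> f a"
    using Hahn_Banach_cone[OF sublinear_norm assms(2,3)] \<open>M \<ge> 0\<close> by metis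
  have bound: "\<bar>f x\<bar> \<le> M * norm x" for x
    using f(2)[of x] f(2)[of "- x"] by (simp add: linear_neg[OF f(1)] abs_le_iff)
  then have "bounded_linear f"
    using f(1) by (intro linear_conv_bounded_linear[THEN iffD2] bounded_linear_intro[where K = M])
      (auto simp: linear_add linear_cmul mult.commute)
  then have "blinfun_apply (Blinfun f) = f" by (rule bounded_linear_Blinfun_apply)
  moreover from this have "norm (Blinfun f) \<le> M"
    using bound \<open>M \<ge> 0\<close> by (intro norm_blinfun_bound) auto
  ultimately show thesis
    using that[of "Blinfun f"] f(3) by simp
qed

section \<open>Norming functionals, separation, and the moment problem\<close>

corollary norming_functional:
  fixes x :: "'a::real_normed_vector"
  obtains f :: "'a \<Rightarrow>\<^sub>L real" where "norm f \<le> 1" and "f x = norm x"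
proof -
  define A where "A = {(t *\<^sub>R x, t * norm x) | t. t \<ge> 0}"
  have "convex_cone ((\<lambda>t. t *\<^sub>R (x, norm x)) ` {0..})"
    by (intro convex_cone_linear_image) (auto simp: convex_cone_iff linear_iff algebra_simps)
  moreover have "(\<lambda>t. t *\<^sub>R (x, norm x)) ` {0..} = A"
    by (auto simp: A_def)
  ultimately have "convex_cone A" by simp
  then obtain f :: "'a \<Rightarrow>\<^sub>L real" where f: "norm f \<le> 1" "\<And>a b. (a, b) \<in> A \<Longrightarrow> b \<le> f a"
    by (rule bounded_functional_above_cone[rotated]) (auto simp: A_def)
  have "norm x \<le> f x"
    by (rule f(2)) (auto simp: A_def intro!: exI[of _ 1])
  moreover have "f x \<le> norm x"
    using norm_blinfun[of f x] f(1) mult_right_mono[OF f(1) norm_ge_zero[of x]] by simp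
  ultimately show thesis using that f(1) by simp
qed

text \<open>Let \<open>d\<close> be a lower bound for the distance from \<open>z\<close> to points of \<open>K\<close>. The pairs \<open>(x - z, d)\<close> with
  \<open>x \<in> K\<close> span a convex cone, since \<open>K\<close> is convex, and satisfy \<open>d \<le> norm (x - z)\<close>, so a functional
  of norm at most 1 lies above them.\<close>

corollary separation_closed_convex:
  fixes K :: "'a::real_normed_vector set"
  assumes "closed K" and "convex K" and "z \<notin> K"
  obtains f :: "'a \<Rightarrow>\<^sub>L real" and d where "d > 0" and "\<And>x. x \<in> K \<Longrightarrow> f z + d \<le> f x"
proof -
  obtain d where d: "d > 0" "\<And>x. x \<in> K \<Longrightarrow> d \<le> dist x z"
  proof -
    have "open (- K)" "z \<in> - K" using assms by auto
    then obtain d where "d > 0" "ball z d \<subseteq> - K" using openE by blast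
    then have "d \<le> dist x z" if "x \<in> K" for x
      using that by (metis ComplD dist_commute in_mono linorder_not_less mem_ball)
    then show thesis using that \<open>d > 0\<close> by blast
  qed
  define A where "A = {(t *\<^sub>R (x - z), t * d) | t x. t \<ge> 0 \<and> x \<in> K} \<union> {0}"
  have "convex_cone A"
    unfolding convex_cone_iff
  proof (intro conjI ballI allI impI)
    fix u v assume "u \<in> A" "v \<in> A"
    then consider "u = 0 \<or> v = 0" | s x t y where "s \<ge> 0" "t \<ge> 0" "x \<in> K" "y \<in> K"
      "u = (s *\<^sub>R (x - z), s * d)" "v = (t *\<^sub>R (y - z), t * d)"
      by (auto simp: A_def)
    then show "u + v \<in> A"
    proof cases
      case 1 with \<open>u \<in> A\<close> \<open>v \<in> A\<close> show ?thesis by auto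
    next
      case 2
      show ?thesis
      proof (cases "s + t = 0")
        case True
        with 2 have "s = 0" "t = 0" by auto
        with 2 show ?thesis by (auto simp: A_def zero_prod_def)
      next
        case False
        define w where "w = (s / (s + t)) *\<^sub>R x + (t / (s + t)) *\<^sub>R y"
        have "w \<in> K" unfolding w_def
          using 2 False by (intro convexD[OF \<open>convex K\<close>]) (auto simp flip: add_divide_distrib)
        moreover have "(s + t) *\<^sub>R (w - z) = s *\<^sub>R (x - z) + t *\<^sub>R (y - z)"
          using False by (simp add: w_def scaleR_diff_right scaleR_add_right scaleR_add_left)
        ultimately have "u + v = ((s + t) *\<^sub>R (w - z), (s + t) * d)" "w \<in> K" "s + t \<ge> 0"
          using 2 by (simp_all add: algebra_simps)
        then show ?thesis unfolding A_def by blast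
      qed
    qed
  next
    fix u and c :: real assume "u \<in> A" "c \<ge> 0"
    then consider "u = 0" | s x where "s \<ge> 0" "x \<in> K" "u = (s *\<^sub>R (x - z), s * d)"
      by (auto simp: A_def)
    then show "c *\<^sub>R u \<in> A"
    proof cases
      case 2
      then have "c *\<^sub>R u = ((c * s) *\<^sub>R (x - z), (c * s) * d)" "c * s \<ge> 0"
        using \<open>c \<ge> 0\<close> by simp_all
      then show ?thesis using 2 unfolding A_def by blast
    qed (simp add: A_def)
  qed (simp add: A_def)
  moreover have "b \<le> 1 * norm a" if "(a, b) \<in> A" for a b
    using that d(2) by (auto simp: A_def dist_norm mult_left_mono zero_prod_def)
  ultimately obtain f :: "'a \<Rightarrow>\<^sub>L real" where f: "\<And>a b. (a, b) \<in> A \<Longrightarrow> b \<le> f a"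
    using bounded_functional_above_cone[of 1 A] by (metis zero_le_one)
  show thesis
  proof (rule that[OF d(1)])
    fix x assume "x \<in> K"
    then have "(x - z, d) \<in> A" by (auto simp: A_def intro!: exI[of _ 1])
    then have "d \<le> f (x - z)" by (rule f)
    then show "f z + d \<le> f x" by (simp add: blinfun.bilinear_simps)
  qed
qed

lemma span_range_explicit:
  fixes g :: "nat \<Rightarrow> 'a::real_vector"
  assumes "v \<in> span (range g)"
  obtains a N where "v = (\<Sum>k<N. a k *\<^sub>R g k)"
proof -
  have "\<exists>a N. v = (\<Sum>k<N. a k *\<^sub>R g k)"
    using assms
  proof (induction rule: span_induct_alt)
    case base
    show ?case by (rule exI[of _ "\<lambda>_. 0"]) simp
  next
    case (step c w v)
    then obtain j a N where w: "w = g j" and v: "v = (\<Sum>k<N. a k *\<^sub>R g k)" by blast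
    define L where "L = max N (Suc j)"
    define a' where "a' k = (if k < N then a k else 0) + (if k = j then c else 0)" for k
    have "(\<Sum>k<L. a' k *\<^sub>R g k) = (\<Sum>k<L. if k < N then a k *\<^sub>R g k else 0) +
        (\<Sum>k<L. if k = j then c *\<^sub>R g k else 0)"
      unfolding sum.distrib[symmetric] by (rule sum.cong) (simp_all add: a'_def scaleR_left_distrib)
    also have "(\<Sum>k<L. if k < N then a k *\<^sub>R g k else 0) = (\<Sum>k<N. a k *\<^sub>R g k)"
      by (rule sum.mono_neutral_cong_right) (auto simp: L_def)
    also have "(\<Sum>k<L. if k = j then c *\<^sub>R g k else 0) = c *\<^sub>R g j"
      by (simp add: L_def less_max_iff_disj)
    finally show ?case using w v by (metis add.commute)
  qed
  then show thesis using that by blast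
qed

text \<open>The cone here is a subspace, which contains with each pair also its negative, so that the lower
  bounds \<open>b k\<close> become exact values.\<close>

corollary Helly_moment:
  fixes x :: "nat \<Rightarrow> 'a::real_normed_vector" and b :: "nat \<Rightarrow> real"
  assumes "M \<ge> 0"
    and le: "\<And>a N. \<bar>\<Sum>k<N. a k * b k\<bar> \<le> M * norm (\<Sum>k<N. a k *\<^sub>R x k)"
  obtains f :: "'a \<Rightarrow>\<^sub>L real" where "norm f \<le> M" and "\<And>k. f (x k) = b k"
proof -
  define A where "A = span (range (\<lambda>k. (x k, b k)))"
  have "\<beta> \<le> M * norm \<alpha>" if "(\<alpha>, \<beta>) \<in> A" for \<alpha> \<beta>
  proof -
    obtain a N where "(\<alpha>, \<beta>) = (\<Sum>k<N. a k *\<^sub>R (x k, b k))"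
      using span_range_explicit \<open>(\<alpha>, \<beta>) \<in> A\<close> unfolding A_def by blast
    then have "\<alpha> = (\<Sum>k<N. a k *\<^sub>R x k)" "\<beta> = (\<Sum>k<N. a k * b k)"
      by (simp_all add: prod_eq_iff fst_sum snd_sum)
    then show ?thesis using le[where a = a and N = N] by simp
  qed
  then obtain f :: "'a \<Rightarrow>\<^sub>L real" where f: "norm f \<le> M" "\<And>\<alpha> \<beta>. (\<alpha>, \<beta>) \<in> A \<Longrightarrow> \<beta> \<le> f \<alpha>"
    using bounded_functional_above_cone[OF \<open>M \<ge> 0\<close>, of A] convex_cone_span unfolding A_def by blast
  have "f (x k) = b k" for k
  proof -
    have "(x k, b k) \<in> A" by (simp add: A_def span_base)
    moreover from this have "(- x k, - b k) \<in> A"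
      unfolding A_def using span_neg by fastforce
    ultimately show ?thesis
      using f(2)[of "x k" "b k"] f(2)[of "- x k" "- b k"] by (simp add: blinfun.bilinear_simps)
  qed
  then show thesis using that f(1) by blast
qed

section \<open>Fixed points in weakly compact sets\<close>

lemma topspace_weak_topology [simp]: "topspace weak_topology = UNIV"
proof -
  have "(\<lambda>_. 0 :: real) -` UNIV \<in> {f -` U | (f :: 'a \<Rightarrow> real) U. bounded_linear f \<and> open U}"
    using bounded_linear_zero by blast
  then show ?thesis
    unfolding weak_topology_def topology_generated_by_topspace by auto
qed

lemma openin_weak_topology_vimage:
  "openin weak_topology (blinfun_apply f -` U)" if "open U" for U :: "real set"
  unfolding weak_topology_def
  by (rule topology_generated_by_Basis) (use that blinfun.bounded_linear_right in blast)

lemma closedin_weak_topology_convex: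
  fixes K :: "'a::real_normed_vector set"
  assumes "closed K" and "convex K"
  shows "closedin weak_topology K"
proof -
  have "\<exists>U. openin weak_topology U \<and> z \<in> U \<and> U \<subseteq> - K" if "z \<in> - K" for z
  proof -
    obtain f :: "'a \<Rightarrow>\<^sub>L real" and d where "d > 0" "\<And>x. x \<in> K \<Longrightarrow> f z + d \<le> f x"
      using separation_closed_convex[OF assms] \<open>z \<in> - K\<close> by blast
    then have "openin weak_topology (blinfun_apply f -` {..<f z + d})"
      "z \<in> blinfun_apply f -` {..<f z + d}" "blinfun_apply f -` {..<f z + d} \<subseteq> - K"
      by (force intro: openin_weak_topology_vimage)+
    then show ?thesis by blast
  qed
  then have "openin weak_topology (- K)"
    by (subst openin_subopen) blast
  then show ?thesis by (simp add: closedin_def Compl_eq_Diff_UNIV)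
qed

text \<open>The average of the first \<open>n + 1\<close> points of an orbit is moved by the affine map \<open>f\<close> by the
  telescoping amount \<open>(1 / (n + 1)) *\<^sub>R ((f ^^ Suc n) x0 - x0)\<close>, which is small as \<open>K\<close> is bounded. The
  averages are built one point at a time because affinity concerns combinations of two points.\<close>

lemma approximate_fixed_points:
  assumes f: "affine_map_on K f" "f ` K \<subseteq> K" and K: "convex K" "bounded K" "K \<noteq> {}" and "e > 0"
  shows "\<exists>x\<in>K. norm (f x - x) \<le> e"
proof -
  obtain x0 where x0: "x0 \<in> K" using K by blast
  obtain B where B: "\<And>x y. x \<in> K \<Longrightarrow> y \<in> K \<Longrightarrow> norm (x - y) \<le> B"
    using K(2) unfolding bounded_two_points dist_norm by blast
  have iter: "(f ^^ n) x0 \<in> K" for n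
    by (induction n) (use x0 f(2) in auto)
  have "\<exists>a\<in>K. f a - a = (1 / (n + 1)) *\<^sub>R ((f ^^ Suc n) x0 - x0)" for n :: nat
  proof (induction n)
    case 0
    then show ?case using x0 by (intro bexI[of _ x0]) simp_all
  next
    case (Suc n)
    then obtain a where a: "a \<in> K" "f a - a = (1 / (n + 1)) *\<^sub>R ((f ^^ Suc n) x0 - x0)" by blast
    \<comment> \<open>If \<open>a\<close> is the average of \<open>n + 1\<close> points and \<open>y\<close> is the next one, then \<open>t *\<^sub>R a + (1 - t) *\<^sub>R y\<close> is
      the average of \<open>n + 2\<close> points.\<close>
    define t :: real where "t = (n + 1) / (n + 2)"
    have t: "t \<in> {0..1}" "1 - t = 1 / (n + 2)" "t * (1 / (n + 1)) = 1 / (n + 2)"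
      by (auto simp: t_def field_simps)
    define y where "y = (f ^^ Suc n) x0"
    define a' where "a' = t *\<^sub>R a + (1 - t) *\<^sub>R y"
    have y: "y \<in> K" unfolding y_def by (rule iter)
    have "a' \<in> K" unfolding a'_def using a(1) y t(1) K(1) by (intro convexD) auto
    moreover have "f a' - a' = (1 / (Suc n + 1)) *\<^sub>R ((f ^^ Suc (Suc n)) x0 - x0)"
    proof -
      have "f a' = t *\<^sub>R f a + (1 - t) *\<^sub>R f y"
        using f(1) a(1) y t(1) unfolding affine_map_on_def a'_def by blast
      then have "f a' - a' = t *\<^sub>R (f a - a) + (1 - t) *\<^sub>R (f y - y)"
        by (simp add: a'_def algebra_simps)
      also have "\<dots> = (1 / (n + 2)) *\<^sub>R (y - x0) + (1 / (n + 2)) *\<^sub>R (f y - y)"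
        by (simp only: a(2) y_def[symmetric] scaleR_scaleR t)
      also have "\<dots> = (1 / (n + 2)) *\<^sub>R (f y - x0)"
        by (simp flip: scaleR_right_distrib)
      finally show ?thesis by (simp add: y_def add.commute)
    qed
    ultimately show ?case by blast
  qed
  moreover obtain n :: nat where n: "B / e < n" using reals_Archimedean2 by blast
  ultimately obtain a where a: "a \<in> K" "f a - a = (1 / (n + 1)) *\<^sub>R ((f ^^ Suc n) x0 - x0)" by blast
  have "norm (f a - a) = (1 / (n + 1)) * norm ((f ^^ Suc n) x0 - x0)"
    by (simp only: a(2) norm_scaleR) simp
  also have "\<dots> \<le> (1 / (n + 1)) * B"
    using B[OF iter[of "Suc n"] x0] by (intro mult_left_mono) auto
  also have "\<dots> \<le> e" using n \<open>e > 0\<close> by (simp add: field_simps)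
  finally show ?thesis using a(1) by blast
qed

text \<open>The almost fixed points for tolerance \<open>e\<close> form a closed convex and therefore weakly closed set,
  by continuity and affinity of \<open>f\<close>. For \<open>e\<close> tending to 0 these sets decrease, and a point in all of
  them is fixed.\<close>

lemma weakly_compact_fixed_point:
  fixes K :: "'a::real_normed_vector set"
  assumes C: "weakly_compact C" and K: "K \<subseteq> C" "K \<noteq> {}" "bounded K" "closed K" "convex K"
    and f: "affine_map_on K f" "f ` K \<subseteq> K" "continuous_on K f"
  shows "\<exists>x\<in>K. f x = x"
proof -
  define D where "D e = {x \<in> K. norm (f x - x) \<le> e}" for e :: real
  have closed: "closed (D e)" for e
  proof -
    have "closedin (top_of_set K) (K \<inter> (\<lambda>x. norm (f x - x)) -` {..e})"
      using f(3) by (intro continuous_closedin_preimage continuous_intros) auto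
    moreover have "K \<inter> (\<lambda>x. norm (f x - x)) -` {..e} = D e" by (auto simp: D_def)
    ultimately show ?thesis using K(4) closedin_closed_trans by metis
  qed
  have convex: "convex (D e)" for e
  proof (rule convexI)
    fix x y u v assume xy: "x \<in> D e" "y \<in> D e" and uv: "0 \<le> u" "0 \<le> v" "u + v = (1::real)"
    have "v = 1 - u" using uv by simp
    have "f (u *\<^sub>R x + (1 - u) *\<^sub>R y) = u *\<^sub>R f x + (1 - u) *\<^sub>R f y"
      using f(1) xy uv unfolding affine_map_on_def D_def by simp
    then have "f (u *\<^sub>R x + v *\<^sub>R y) - (u *\<^sub>R x + v *\<^sub>R y) = u *\<^sub>R (f x - x) + v *\<^sub>R (f y - y)"
      by (simp add: \<open>v = 1 - u\<close> algebra_simps)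
    also have "norm \<dots> \<le> u * norm (f x - x) + v * norm (f y - y)"
      using uv by (intro norm_triangle_le) simp
    also have "\<dots> \<le> u * e + v * e"
      using xy uv by (intro add_mono mult_left_mono) (auto simp: D_def)
    also have "\<dots> = e" using uv by (simp flip: distrib_right)
    finally show "u *\<^sub>R x + v *\<^sub>R y \<in> D e"
      using K(5) xy uv by (auto simp: D_def convexD)
  qed
  have "compact_space (subtopology weak_topology C)"
    using C by (simp add: weakly_compact_def compactin_subspace)
  then have "(\<Inter>n. D (1 / Suc n)) \<noteq> {}"
  proof (rule compact_space_imp_nest)
    fix n
    have "closedin weak_topology (D (1 / Suc n))"
      by (rule closedin_weak_topology_convex[OF closed convex])
    then show "closedin (subtopology weak_topology C) (D (1 / Suc n))"
      by (rule closedin_subset_topspace) (use K(1) in \<open>auto simp: D_def\<close>)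
    show "D (1 / Suc n) \<noteq> {}"
      using approximate_fixed_points[OF f(1,2) K(5,3,2), of "1 / Suc n"] by (auto simp: D_def)
  next
    have "1 / real (Suc (Suc n)) \<le> 1 / Suc n" for n by (simp add: frac_le)
    then show "decseq (\<lambda>n. D (1 / Suc n))"
      unfolding D_def by (intro decseq_SucI) (blast intro: order_trans)
  qed
  then obtain x where x: "\<And>n. x \<in> D (1 / Suc n)" by blast
  have "norm (f x - x) \<le> 0"
    using x LIMSEQ_inverse_real_of_nat
    by (intro LIMSEQ_le_const) (auto simp: D_def inverse_eq_divide)
  then show ?thesis using x by (auto simp: D_def)
qed

section \<open>Weak-star limits in the bidual\<close>

text \<open>The function \<open>F\<close> lies in the closure of the evaluations at points of \<open>C\<close> for the topology of
  pointwise convergence on the dual. For bounded \<open>C\<close> the approximation makes \<open>F\<close> linear and bounded, so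
  that \<open>F\<close> is then an element of the bidual.\<close>

definition weak_star_limit ::
  "'a::real_normed_vector set \<Rightarrow> (('a \<Rightarrow>\<^sub>L real) \<Rightarrow> real) \<Rightarrow> bool" where
  "weak_star_limit C F \<longleftrightarrow>
    (\<forall>\<Phi> e. finite \<Phi> \<longrightarrow> e > 0 \<longrightarrow> (\<exists>x\<in>C. \<forall>f\<in>\<Phi>. \<bar>blinfun_apply f x - F f\<bar> < e))"

lemma weak_star_limitD:
  assumes "weak_star_limit C F" and "finite \<Phi>" and "e > 0"
  obtains x where "x \<in> C" and "\<And>f. f \<in> \<Phi> \<Longrightarrow> \<bar>blinfun_apply f x - F f\<bar> < e"
  using assms unfolding weak_star_limit_def by blast

text \<open>Evaluation is a homeomorphism from \<open>C\<close> with the weak topology onto its image in the product of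
  real lines indexed by the dual. The image lies in a product of compact intervals, so if it were
  closed it would be compact, and so would \<open>C\<close>.\<close>

lemma not_weakly_compact_imp_limit:
  fixes C :: "'a::real_normed_vector set"
  assumes bdd: "bounded C" and nwc: "\<not> weakly_compact C"
  obtains F where "weak_star_limit C F" and "\<And>x. x \<in> C \<Longrightarrow> \<exists>f. F f \<noteq> blinfun_apply f x"
proof -
  define J :: "'a \<Rightarrow> ('a \<Rightarrow>\<^sub>L real) \<Rightarrow> real" where "J x = (\<lambda>f. blinfun_apply f x)" for x
  obtain B where B: "\<And>x. x \<in> C \<Longrightarrow> norm x \<le> B"
    using bdd by (auto simp: bounded_iff)
  define Q :: "(('a \<Rightarrow>\<^sub>L real) \<Rightarrow> real) set" where "Q = (\<Pi>\<^sub>E f\<in>UNIV. {- (norm f * B)..norm f * B})"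
  have "compactin (product_topology (\<lambda>_. euclideanreal) UNIV) Q"
    unfolding Q_def by (simp add: compactin_PiE)
  then have Q: "compactin euclidean Q" by (simp add: euclidean_product_topology)
  have JQ: "J ` C \<subseteq> Q"
  proof -
    have "\<bar>blinfun_apply f x\<bar> \<le> norm f * B" if "x \<in> C" for f :: "'a \<Rightarrow>\<^sub>L real" and x
      using norm_blinfun[of f x] mult_left_mono[OF B[OF that] norm_ge_zero[of f]] by simp
    then show ?thesis by (force simp: J_def Q_def abs_le_iff)
  qed
  have "inj J"
  proof (rule injI)
    fix x y assume "J x = J y"
    then have "blinfun_apply f (x - y) = 0" for f :: "'a \<Rightarrow>\<^sub>L real"
      by (simp add: J_def fun_eq_iff blinfun.diff_right)
    then have "norm (x - y) = 0" by (metis norming_functional)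
    then show "x = y" by simp
  qed
  have "\<not> closed (J ` C)"
  proof
    assume "closed (J ` C)"
    then have "compactin euclidean (J ` C)"
      using closed_compactin[OF Q JQ] by simp
    then have cpt: "compactin (top_of_set (J ` C)) (J ` C)"
      by (simp add: compactin_subtopology)
    have "continuous_map (top_of_set (J ` C)) weak_topology (inv J)"
      unfolding weak_topology_def
    proof (rule continuous_on_generated_topo)
      fix V assume "V \<in> {f -` U | (f :: 'a \<Rightarrow> real) U. bounded_linear f \<and> open U}"
      then obtain f and U :: "real set" where V: "V = f -` U" and "bounded_linear f" "open U" by blast
      have "open {G :: ('a \<Rightarrow>\<^sub>L real) \<Rightarrow> real. G (Blinfun f) \<in> U}"
        using product_topology_basis'[of "{()}" "\<lambda>_. U" "\<lambda>_. Blinfun f"] \<open>open U\<close> by simp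
      moreover have "inv J -` V \<inter> topspace (top_of_set (J ` C))
          = J ` C \<inter> {G. G (Blinfun f) \<in> U}"
      proof -
        have "J x (Blinfun f) = f x" for x
          by (simp add: J_def bounded_linear_Blinfun_apply[OF \<open>bounded_linear f\<close>])
        then show ?thesis using \<open>inj J\<close> by (auto simp: V inv_f_f)
      qed
      ultimately show "openin (top_of_set (J ` C)) (inv J -` V \<inter> topspace (top_of_set (J ` C)))"
        by (simp add: openin_open_Int)
    next
      have "topspace (weak_topology :: 'a topology) = UNIV" by simp
      then show "inv J ` topspace (top_of_set (J ` C))
          \<subseteq> \<Union> {f -` U | (f :: 'a \<Rightarrow> real) U. bounded_linear f \<and> open U}"
        unfolding weak_topology_def topology_generated_by_topspace by simp
    qed
    then have "compactin weak_topology (inv J ` J ` C)"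
      by (rule image_compactin[OF cpt])
    moreover have "inv J ` J ` C = C"
      using \<open>inj J\<close> by (simp add: image_image inv_f_f)
    ultimately show False using nwc by (simp add: weakly_compact_def)
  qed
  then obtain F where F: "F \<in> closure (J ` C)" "F \<notin> J ` C"
    unfolding closure_subset_eq[symmetric] by blast
  show thesis
  proof (rule that)
    show "\<exists>f. F f \<noteq> blinfun_apply f x" if "x \<in> C" for x
      using that F(2) by (auto simp: J_def image_iff fun_eq_iff)
    show "weak_star_limit C F"
      unfolding weak_star_limit_def
    proof (intro allI impI)
      fix \<Phi> :: "('a \<Rightarrow>\<^sub>L real) set" and e :: real
      assume "finite \<Phi>" "e > 0"
      define W where "W = {G. \<forall>f\<in>\<Phi>. G f \<in> ball (F f) e}"
      have "open W"
        using product_topology_basis'[of \<Phi> "\<lambda>f. ball (F f) e" id] \<open>finite \<Phi>\<close> by (simp add: W_def)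
      moreover have "F \<in> W" using \<open>e > 0\<close> by (simp add: W_def)
      ultimately have "W \<inter> J ` C \<noteq> {}"
        using F(1) open_Int_closure_eq_empty[of W "J ` C"] by blast
      then obtain G where "G \<in> J ` C" "\<And>f. f \<in> \<Phi> \<Longrightarrow> G f \<in> ball (F f) e"
        by (auto simp: W_def)
      then show "\<exists>x\<in>C. \<forall>f\<in>\<Phi>. \<bar>blinfun_apply f x - F f\<bar> < e"
        by (force simp: J_def dist_real_def abs_minus_commute)
    qed
  qed
qed

lemma weak_star_limit_bounded_linear:
  fixes C :: "'a::real_normed_vector set"
  assumes F: "weak_star_limit C F" and "bounded C"
  shows "bounded_linear F"
proof -
  obtain B where B: "\<And>x. x \<in> C \<Longrightarrow> norm x \<le> B"
    using \<open>bounded C\<close> by (auto simp: bounded_iff)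
  have zero: "t = 0" if "\<And>e. e > 0 \<Longrightarrow> \<bar>t\<bar> \<le> e * k" for t k :: real
  proof (rule ccontr)
    assume "t \<noteq> 0"
    define e where "e = \<bar>t\<bar> / (2 * (\<bar>k\<bar> + 1))"
    have "e > 0" using \<open>t \<noteq> 0\<close> by (simp add: e_def)
    have "\<bar>t\<bar> \<le> e * k" by (rule that) fact
    also have "\<dots> \<le> e * (\<bar>k\<bar> + 1)" using \<open>e > 0\<close> by (intro mult_left_mono) auto
    also have "\<dots> = \<bar>t\<bar> / 2" by (simp add: e_def field_simps)
    finally show False using \<open>t \<noteq> 0\<close> by simp
  qed
  show ?thesis
  proof (rule bounded_linear_intro)
    fix f g
    have "\<bar>F (f + g) - (F f + F g)\<bar> \<le> e * 3" if e: "e > 0" for e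
    proof -
      obtain x where x: "\<And>h. h \<in> {f, g, f + g} \<Longrightarrow> \<bar>blinfun_apply h x - F h\<bar> < e"
        using weak_star_limitD[OF F _ e, of "{f, g, f + g}"] by blast
      show ?thesis
        using x[of f] x[of g] x[of "f + g"] by (simp add: blinfun.add_left)
    qed
    then show "F (f + g) = F f + F g" using zero by force
  next
    fix c f
    have "\<bar>F (c *\<^sub>R f) - c * F f\<bar> \<le> e * (1 + \<bar>c\<bar>)" if e: "e > 0" for e
    proof -
      obtain x where x: "\<And>h. h \<in> {f, c *\<^sub>R f} \<Longrightarrow> \<bar>blinfun_apply h x - F h\<bar> < e"
        using weak_star_limitD[OF F _ e, of "{f, c *\<^sub>R f}"] by blast
      have "F (c *\<^sub>R f) - c * F f = c * (f x - F f) - ((c *\<^sub>R f) x - F (c *\<^sub>R f))"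
        by (simp add: blinfun.scaleR_left algebra_simps)
      also have "\<bar>\<dots>\<bar> \<le> \<bar>c\<bar> * \<bar>f x - F f\<bar> + \<bar>(c *\<^sub>R f) x - F (c *\<^sub>R f)\<bar>"
        by (metis abs_mult abs_triangle_ineq4)
      also have "\<dots> \<le> \<bar>c\<bar> * e + e"
        using x[of f] x[of "c *\<^sub>R f"] by (intro add_mono mult_left_mono) auto
      finally show ?thesis by (simp add: algebra_simps)
    qed
    then have "F (c *\<^sub>R f) - c * F f = 0" by (rule zero)
    then show "F (c *\<^sub>R f) = c *\<^sub>R F f" by simp
  next
    fix f
    have "\<bar>F f\<bar> \<le> norm f * B + e" if e: "e > 0" for e
    proof -
      obtain x where x: "x \<in> C" "\<bar>blinfun_apply f x - F f\<bar> < e"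
        using weak_star_limitD[OF F _ e, of "{f}"] by blast
      have "\<bar>blinfun_apply f x\<bar> \<le> norm f * B"
        using norm_blinfun[of f x] mult_left_mono[OF B[OF x(1)] norm_ge_zero[of f]] by simp
      then show ?thesis using x(2) by linarith
    qed
    then show "norm (F f) \<le> norm f * B" unfolding real_norm_def by (rule field_le_epsilon)
  qed
qed

text \<open>Were \<open>F\<close> the evaluation at some \<open>x\<close> outside \<open>C\<close>, a functional separating \<open>x\<close> from \<open>C\<close> would
  contradict the approximation of \<open>F\<close> by points of \<open>C\<close>.\<close>

lemma weak_star_limit_not_evaluation:
  fixes C :: "'a::real_normed_vector set"
  assumes F: "weak_star_limit C F" and C: "closed C" "convex C"
    and ne: "\<And>x. x \<in> C \<Longrightarrow> \<exists>f. F f \<noteq> blinfun_apply f x"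
  shows "\<exists>f. F f \<noteq> blinfun_apply f x"
proof (rule ccontr)
  assume eq: "\<not> ?thesis"
  then have "x \<notin> C" using ne by blast
  then obtain f :: "'a \<Rightarrow>\<^sub>L real" and d where d: "d > 0" "\<And>y. y \<in> C \<Longrightarrow> f x + d \<le> f y"
    using separation_closed_convex[OF C] by blast
  then obtain y where "y \<in> C" "\<bar>blinfun_apply f y - F f\<bar> < d"
    using weak_star_limitD[OF F, of "{f}" d] by auto
  then show False using d(2)[of y] eq by simp
qed

text \<open>The evaluations form an isometric copy of a complete space: points whose evaluations approach \<open>F\<close>
  uniformly on the unit ball of the dual form a Cauchy sequence, and \<open>F\<close> is the evaluation at its
  limit.\<close>

lemma positive_distance_from_evaluations:
  fixes F :: "('a::banach \<Rightarrow>\<^sub>L real) \<Rightarrow> real"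
  assumes ne: "\<And>x. \<exists>f. F f \<noteq> blinfun_apply f x"
  obtains \<delta> where "\<delta> > 0" and "\<And>x. \<exists>f. \<bar>F f - blinfun_apply f x\<bar> > \<delta> * norm f"
proof -
  have "\<exists>\<delta>>0. \<forall>x. \<exists>f. \<bar>F f - blinfun_apply f x\<bar> > \<delta> * norm f"
  proof (rule ccontr)
    assume "\<not> ?thesis"
    then have "\<exists>x. \<forall>f. \<bar>F f - blinfun_apply f x\<bar> \<le> \<delta> * norm f" if "\<delta> > 0" for \<delta>
      using that by (meson not_le)
    then have "\<exists>x. \<forall>f. \<bar>F f - blinfun_apply f x\<bar> \<le> inverse (Suc n) * norm f" for n :: nat
      by simp
    then obtain x where x: "\<And>n f. \<bar>F f - blinfun_apply f (x n)\<bar> \<le> inverse (Suc n) * norm f"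
      by metis
    have dist: "norm (x m - x n) \<le> inverse (Suc m) + inverse (Suc n)" for m n
    proof -
      obtain f :: "'a \<Rightarrow>\<^sub>L real" where f: "norm f \<le> 1" "f (x m - x n) = norm (x m - x n)"
        by (rule norming_functional)
      have "norm (x m - x n) \<le> inverse (Suc m) * norm f + inverse (Suc n) * norm f"
        using x[of f m] x[of f n] by (simp add: f(2)[symmetric] blinfun.diff_right)
      also have "\<dots> \<le> inverse (Suc m) * 1 + inverse (Suc n) * 1"
        using f(1) by (intro add_mono mult_left_mono) auto
      finally show ?thesis by simp
    qed
    have "Cauchy x"
    proof (rule CauchyI)
      fix e :: real assume "e > 0"
      then obtain N where N: "inverse (Suc N) < e / 2" using reals_Archimedean[of "e / 2"] by auto
      have "inverse (Suc n) < e / 2" if "n \<ge> N" for n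
      proof -
        have "inverse (real (Suc n)) \<le> inverse (Suc N)" using that by (intro le_imp_inverse_le) auto
        then show ?thesis using N by linarith
      qed
      then have "norm (x m - x n) < e" if "m \<ge> N" "n \<ge> N" for m n
        using dist[of m n] that by (smt (verit) field_sum_of_halves)
      then show "\<exists>N. \<forall>m\<ge>N. \<forall>n\<ge>N. norm (x m - x n) < e" by blast
    qed
    then obtain l where l: "x \<longlonglongrightarrow> l"
      using Cauchy_convergent_iff convergent_def by blast
    have "F f = blinfun_apply f l" for f
    proof -
      have "(\<lambda>n. inverse (real (Suc n)) * norm f) \<longlonglongrightarrow> 0"
        using tendsto_mult_left_zero[OF LIMSEQ_inverse_real_of_nat] by simp
      then have "(\<lambda>n. F f - blinfun_apply f (x n)) \<longlonglongrightarrow> 0"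
        by (rule Lim_null_comparison[rotated]) (use x in auto)
      moreover have "(\<lambda>n. F f - blinfun_apply f (x n)) \<longlonglongrightarrow> F f - blinfun_apply f l"
        by (intro tendsto_intros l)
      ultimately show ?thesis using LIMSEQ_unique by fastforce
    qed
    then show False using ne by blast
  qed
  then show thesis using that by blast
qed

text \<open>Linear algebra: a functional that vanishes on the common kernel of finitely many functionals is a
  linear combination of them, and a linear combination of evaluations is again an evaluation. In the
  induction, \<open>u\<close> is an element of the kernels for \<open>S\<close> that detects \<open>s\<close>; subtracting a multiple
  of the evaluation at \<open>s\<close> makes \<open>L\<close> vanish on those kernels.\<close>

lemma evaluation_if_vanishes_on_kernels:
  fixes L :: "('a::real_normed_vector \<Rightarrow>\<^sub>L real) \<Rightarrow> real"
  assumes "finite S" and "linear L" and "\<And>f. (\<And>x. x \<in> S \<Longrightarrow> blinfun_apply f x = 0) \<Longrightarrow> L f = 0"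
  shows "\<exists>y. \<forall>f. L f = blinfun_apply f y"
  using assms
proof (induction S arbitrary: L rule: finite_induct)
  case empty
  then show ?case by (intro exI[of _ 0]) (simp add: blinfun.zero_right)
next
  case (insert s S)
  show ?case
  proof (cases "\<exists>u :: 'a \<Rightarrow>\<^sub>L real. (\<forall>x\<in>S. u x = 0) \<and> u s \<noteq> 0")
    case False
    then show ?thesis using insert.prems by (intro insert.IH) auto
  next
    case True
    then obtain u :: "'a \<Rightarrow>\<^sub>L real" where u: "\<And>x. x \<in> S \<Longrightarrow> u x = 0" "u s \<noteq> 0" by blast
    define c where "c = L u / u s"
    have "\<exists>y. \<forall>f. L f - c * blinfun_apply f s = blinfun_apply f y"
    proof (rule insert.IH)
      show "linear (\<lambda>f. L f - c * blinfun_apply f s)"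
        by (rule linearI)
          (simp_all add: linear_add[OF insert.prems(1)] linear_scale[OF insert.prems(1)]
            blinfun.bilinear_simps algebra_simps)
    next
      fix f :: "'a \<Rightarrow>\<^sub>L real" assume f: "\<And>x. x \<in> S \<Longrightarrow> f x = 0"
      define g where "g = f - (f s / u s) *\<^sub>R u"
      have "L g = 0"
        by (rule insert.prems(2)) (use f u in \<open>auto simp: g_def blinfun.bilinear_simps\<close>)
      then show "L f - c * f s = 0"
        by (simp add: g_def c_def linear_diff[OF insert.prems(1)] linear_scale[OF insert.prems(1)])
    qed
    then obtain y where "\<And>f. L f = blinfun_apply f (y + c *\<^sub>R s)"
      by (auto simp: blinfun.bilinear_simps algebra_simps)
    then show ?thesis by blast
  qed
qed

text \<open>Let \<open>N\<close> consist of the functionals that vanish on \<open>S\<close>. If \<open>F\<close> had norm at most \<open>\<delta>\<close> on \<open>N\<close>, a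
  Hahn-Banach extension \<open>G\<close> of that restriction would differ from \<open>F\<close> by a functional vanishing on \<open>N\<close>, that
  is, by an evaluation. So \<open>F\<close> would be within distance \<open>\<delta>\<close> of an evaluation.\<close>

lemma functional_separating_from_finite_set:
  fixes F :: "('a::real_normed_vector \<Rightarrow>\<^sub>L real) \<Rightarrow> real"
  assumes F: "bounded_linear F" and "\<delta> > 0"
    and \<delta>: "\<And>x. \<exists>f. \<bar>F f - blinfun_apply f x\<bar> > \<delta> * norm f"
    and "finite S"
  obtains f where "norm f \<le> 1 / \<delta>" and "F f = 1" and "\<And>x. x \<in> S \<Longrightarrow> blinfun_apply f x = 0"
proof -
  define N :: "('a \<Rightarrow>\<^sub>L real) set" where "N = {f. \<forall>x\<in>S. blinfun_apply f x = 0}"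
  have F': "linear F" using F by (simp add: bounded_linear.linear)
  have "\<exists>f\<in>N. \<bar>F f\<bar> > \<delta> * norm f"
  proof (rule ccontr)
    assume not: "\<not> ?thesis"
    define A where "A = (\<lambda>f. (f, F f)) ` N"
    have "subspace N" by (auto simp: N_def subspace_def blinfun.bilinear_simps)
    then have "subspace A"
      unfolding A_def
      by (intro linear_subspace_image linearI) (simp_all add: linear_add[OF F'] linear_scale[OF F'])
    then have "convex_cone A" by (rule subspace_imp_convex_cone)
    moreover have "\<beta> \<le> \<delta> * norm f" if "(f, \<beta>) \<in> A" for f \<beta>
      using that not by (force simp: A_def)
    ultimately obtain G :: "('a \<Rightarrow>\<^sub>L real) \<Rightarrow>\<^sub>L real"
      where G: "norm G \<le> \<delta>" "\<And>f \<beta>. (f, \<beta>) \<in> A \<Longrightarrow> \<beta> \<le> G f"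
      using bounded_functional_above_cone[of \<delta> A] \<open>\<delta> > 0\<close> by (metis less_imp_le)
    have "F f - G f = 0" if "f \<in> N" for f
    proof -
      have "- f \<in> N" using that by (simp add: N_def blinfun.minus_left)
      then show ?thesis
        using G(2)[of f "F f"] G(2)[of "- f" "F (- f)"] that
        by (simp add: A_def image_iff blinfun.minus_right linear_neg[OF F'])
    qed
    moreover have "linear (\<lambda>f. F f - G f)"
      by (rule linearI)
        (simp_all add: linear_add[OF F'] linear_scale[OF F'] blinfun.bilinear_simps algebra_simps)
    ultimately obtain y where y: "\<And>f. F f - G f = blinfun_apply f y"
      using evaluation_if_vanishes_on_kernels[OF \<open>finite S\<close>, of "\<lambda>f. F f - G f"]
      by (auto simp: N_def)
    obtain f where "\<bar>F f - blinfun_apply f y\<bar> > \<delta> * norm f" using \<delta> by blast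
    moreover have "F f - blinfun_apply f y = G f" using y[of f] by simp
    moreover have "\<bar>G f\<bar> \<le> \<delta> * norm f"
      using norm_blinfun[of G f] mult_right_mono[OF G(1) norm_ge_zero[of f]] by simp
    ultimately show False by simp
  qed
  then obtain f where f: "f \<in> N" "\<bar>F f\<bar> > \<delta> * norm f" by blast
  have "F f \<noteq> 0" using f(2) \<open>\<delta> > 0\<close> by (smt (verit) mult_nonneg_nonneg norm_ge_zero)
  show thesis
  proof (rule that[of "(1 / F f) *\<^sub>R f"])
    show "F ((1 / F f) *\<^sub>R f) = 1" using \<open>F f \<noteq> 0\<close> by (simp add: linear_scale[OF F'])
    show "norm ((1 / F f) *\<^sub>R f) \<le> 1 / \<delta>"
      using f(2) \<open>F f \<noteq> 0\<close> \<open>\<delta> > 0\<close> by (simp add: field_simps)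
    show "blinfun_apply ((1 / F f) *\<^sub>R f) x = 0" if "x \<in> S" for x
      using f(1) that by (simp add: N_def blinfun.scaleR_left)
  qed
qed

section \<open>Summing systems in sets that are not weakly compact\<close>

text \<open>If \<open>\<phi> m\<close> took the value 1 exactly at every \<open>x k\<close> with \<open>m \<le> k\<close>, then \<open>\<phi> m\<close> applied to the linear
  combination would be the tail sum from \<open>m\<close>, and \<open>R\<close> would do as the constant. The errors are
  weighted by the coefficients \<open>a k\<close>, which are differences of consecutive tail sums, hence at most
  twice the largest tail sum \<open>T\<close>. As the error bounds add up to at most 1/4, this costs
  at most \<open>T / 2\<close>, which is absorbed into the left-hand side at the price of doubling \<open>R\<close>.\<close>

lemma tail_sums_bounded:
  fixes x :: "nat \<Rightarrow> 'a::real_normed_vector" and \<phi> :: "nat \<Rightarrow> 'a \<Rightarrow>\<^sub>L real"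
  assumes R: "\<And>i. norm (\<phi> i) \<le> R"
    and zero: "\<And>i k. k < i \<Longrightarrow> \<phi> i (x k) = 0"
    and one: "\<And>i k. i \<le> k \<Longrightarrow> \<bar>\<phi> i (x k) - 1\<bar> \<le> (1/2) ^ (k + 3)"
  shows "\<bar>\<Sum>k\<in>{m..<N}. a k\<bar> \<le> 2 * R * norm (\<Sum>k<N. a k *\<^sub>R x k)"
proof -
  define y where "y = (\<Sum>k<N. a k *\<^sub>R x k)"
  define s where "s j = (\<Sum>k\<in>{j..<N}. a k)" for j
  define T where "T = Max ((\<lambda>j. \<bar>s j\<bar>) ` {..N})"
  have s_le: "\<bar>s j\<bar> \<le> T" for j
  proof (cases "j \<le> N")
    case True
    then show ?thesis unfolding T_def by (intro Max_ge) auto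
  next
    case False
    then have "s j = s N" by (simp add: s_def)
    then show ?thesis unfolding T_def by (intro Max_ge) auto
  qed
  have a_le: "\<bar>a k\<bar> \<le> 2 * T" if "k < N" for k
  proof -
    have "s k = a k + s (Suc k)" using that by (simp add: s_def sum.atLeast_Suc_lessThan)
    then show ?thesis using s_le[of k] s_le[of "Suc k"] by linarith
  qed
  have "T \<ge> 0" using s_le[of 0] by linarith
  have main: "\<bar>s j\<bar> \<le> R * norm y + T / 2" for j
  proof -
    have "\<phi> j y = (\<Sum>k<N. a k * \<phi> j (x k))"
      by (simp add: y_def blinfun.sum_right blinfun.scaleR_right)
    also have "\<dots> = (\<Sum>k\<in>{j..<N}. a k * \<phi> j (x k))"
      by (rule sum.mono_neutral_right) (auto simp: zero not_le)
    finally have "\<phi> j y - s j = (\<Sum>k\<in>{j..<N}. a k * (\<phi> j (x k) - 1))"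
      by (simp add: s_def right_diff_distrib sum_subtractf)
    also have "\<bar>\<dots>\<bar> \<le> (\<Sum>k\<in>{j..<N}. 2 * T * (1/2) ^ (k + 3))"
      using a_le one \<open>T \<ge> 0\<close>
      by (intro sum_abs[THEN order_trans] sum_mono) (auto simp: abs_mult intro!: mult_mono)
    also have "\<dots> \<le> (\<Sum>k<N. 2 * T * (1/2) ^ (k + 3))"
      by (rule sum_mono2) (use \<open>T \<ge> 0\<close> in auto)
    also have "\<dots> = T / 4 * (\<Sum>k<N. (1/2) ^ k)"
      by (simp add: sum_distrib_left power_add field_simps)
    also have "\<dots> \<le> T / 4 * 2"
      using \<open>T \<ge> 0\<close> sum_gp_strict[of "1/2 :: real" N] by (intro mult_left_mono) auto
    finally have "\<bar>\<phi> j y - s j\<bar> \<le> T / 2" by simp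
    moreover have "\<bar>\<phi> j y\<bar> \<le> R * norm y"
      using norm_blinfun[of "\<phi> j" y] mult_right_mono[OF R[of j] norm_ge_zero[of y]] by simp
    ultimately show ?thesis by linarith
  qed
  have "T \<in> (\<lambda>j. \<bar>s j\<bar>) ` {..N}" unfolding T_def by (intro Max_in) auto
  then have "T \<le> R * norm y + T / 2" using main by auto
  then have "T \<le> 2 * R * norm y" by simp
  then show ?thesis using s_le[of m] unfolding s_def y_def by linarith
qed

text \<open>Given points and functionals with indices below \<open>n\<close>, first choose \<open>\<phi> n\<close> vanishing on these points with
  \<open>F (\<phi> n) = 1\<close>, then a point \<open>x n\<close> of \<open>C\<close> that approximates \<open>F\<close> on the functionals up to \<open>\<phi> n\<close>. The
  norms stay bounded because the distance of \<open>F\<close> from all evaluations is bounded below.\<close>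

lemma exists_almost_summing_system:
  fixes C :: "'a::banach set"
  assumes C: "closed C" "convex C" "bounded C" and nwc: "\<not> weakly_compact C"
  obtains x :: "nat \<Rightarrow> 'a" and \<phi> :: "nat \<Rightarrow> 'a \<Rightarrow>\<^sub>L real" and R
  where "\<And>k. x k \<in> C" and "\<And>i. norm (\<phi> i) \<le> R" and "\<And>i k. k < i \<Longrightarrow> \<phi> i (x k) = 0"
    and "\<And>i k. i \<le> k \<Longrightarrow> \<bar>\<phi> i (x k) - 1\<bar> \<le> (1/2) ^ (k + 3)"
proof -
  obtain F where F: "weak_star_limit C F" and ne: "\<And>x. x \<in> C \<Longrightarrow> \<exists>f. F f \<noteq> blinfun_apply f x"
    using not_weakly_compact_imp_limit[OF C(3) nwc] by blast
  have lin: "bounded_linear F" by (rule weak_star_limit_bounded_linear[OF F C(3)])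
  obtain \<delta> where \<delta>: "\<delta> > 0" "\<And>x. \<exists>f. \<bar>F f - blinfun_apply f x\<bar> > \<delta> * norm f"
    using positive_distance_from_evaluations[of F] weak_star_limit_not_evaluation[OF F C(1,2) ne]
    by blast
  define P where "P p \<longleftrightarrow> snd p \<in> C \<and> norm (fst p) \<le> 1 / \<delta> \<and> F (fst p) = 1"
    for p :: "('a \<Rightarrow>\<^sub>L real) \<times> 'a"
  define Q where "Q h n p \<longleftrightarrow> P p \<and> (\<forall>k<n. fst p (snd (h k)) = 0) \<and>
      \<bar>fst p (snd p) - 1\<bar> \<le> (1/2) ^ (n + 3) \<and> (\<forall>i<n. \<bar>fst (h i) (snd p) - 1\<bar> \<le> (1/2) ^ (n + 3))"
    for h :: "nat \<Rightarrow> ('a \<Rightarrow>\<^sub>L real) \<times> 'a" and n p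
  have "\<exists>h. \<forall>n. Q h n (h n)"
  proof (rule dependent_wellorder_choice)
    fix h h' :: "nat \<Rightarrow> ('a \<Rightarrow>\<^sub>L real) \<times> 'a" and n p
    assume "\<And>k. k < n \<Longrightarrow> h k = h' k"
    then show "Q h n p = Q h' n p" by (simp add: Q_def)
  next
    fix n and h :: "nat \<Rightarrow> ('a \<Rightarrow>\<^sub>L real) \<times> 'a"
    assume IH: "\<And>k. k < n \<Longrightarrow> Q h k (h k)"
    obtain f where f: "norm f \<le> 1 / \<delta>" "F f = 1"
      "\<And>x. x \<in> (\<lambda>k. snd (h k)) ` {..<n} \<Longrightarrow> blinfun_apply f x = 0"
      using functional_separating_from_finite_set[OF lin \<delta>, of "(\<lambda>k. snd (h k)) ` {..<n}"] by blast
    obtain y where y: "y \<in> C" "\<And>g. g \<in> insert f ((\<lambda>k. fst (h k)) ` {..<n}) \<Longrightarrow>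
        \<bar>blinfun_apply g y - F g\<bar> < (1/2) ^ (n + 3)"
      by (rule weak_star_limitD[OF F, of "insert f ((\<lambda>k. fst (h k)) ` {..<n})" "(1/2) ^ (n + 3)"])
        auto
    have "F (fst (h k)) = 1" if "k < n" for k using IH[OF that] by (simp add: Q_def P_def)
    then have "Q h n (f, y)"
      using f y(1) y(2)[of f] y(2)[of "fst (h _)"]
      by (force simp: Q_def P_def intro: less_imp_le)
    then show "\<exists>p. Q h n p" by blast
  qed
  then obtain h where h: "\<And>n. Q h n (h n)" by blast
  show thesis
  proof (rule that[of "\<lambda>n. snd (h n)" "\<lambda>n. fst (h n)" "1 / \<delta>"])
    show "snd (h k) \<in> C" for k using h[of k] by (simp add: Q_def P_def)
    show "norm (fst (h i)) \<le> 1 / \<delta>" for i using h[of i] by (simp add: Q_def P_def)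
    show "fst (h i) (snd (h k)) = 0" if "k < i" for i k using h[of i] that by (simp add: Q_def)
    show "\<bar>fst (h i) (snd (h k)) - 1\<bar> \<le> (1/2) ^ (k + 3)" if "i \<le> k" for i k
      using h[of k] that by (cases "i = k") (auto simp: Q_def)
  qed
qed

text \<open>The bound on tail sums is exactly the solvability condition of the moment problem with the values
  \<open>0\<close> before \<open>m\<close> and \<open>1\<close> from \<open>m\<close> on.\<close>

lemma exists_summing_system:
  fixes C :: "'a::banach set"
  assumes C: "closed C" "convex C" "bounded C" and nwc: "\<not> weakly_compact C"
  obtains x :: "nat \<Rightarrow> 'a" and G :: "nat \<Rightarrow> 'a \<Rightarrow>\<^sub>L real" and M
  where "\<And>k. x k \<in> C" and "\<And>m. norm (G m) \<le> M" and "\<And>m k. G m (x k) = (if m \<le> k then 1 else 0)"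
proof -
  obtain x :: "nat \<Rightarrow> 'a" and \<phi> :: "nat \<Rightarrow> 'a \<Rightarrow>\<^sub>L real" and R
    where x: "\<And>k. x k \<in> C" and \<phi>: "\<And>i. norm (\<phi> i) \<le> R" "\<And>i k. k < i \<Longrightarrow> \<phi> i (x k) = 0"
      "\<And>i k. i \<le> k \<Longrightarrow> \<bar>\<phi> i (x k) - 1\<bar> \<le> (1/2) ^ (k + 3)"
    using exists_almost_summing_system[OF assms] by blast
  have "R \<ge> 0" using \<phi>(1)[of 0] norm_ge_zero order_trans by blast
  have "\<exists>g :: 'a \<Rightarrow>\<^sub>L real. norm g \<le> 2 * R \<and> (\<forall>k. blinfun_apply g (x k) = (if m \<le> k then 1 else 0))" for m
  proof -
    have "\<bar>\<Sum>k<N. a k * (if m \<le> k then 1 else 0)\<bar> \<le> 2 * R * norm (\<Sum>k<N. a k *\<^sub>R x k)" for a N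
    proof -
      have "(\<Sum>k<N. a k * (if m \<le> k then 1 else 0)) = (\<Sum>k\<in>{m..<N}. a k)"
        by (rule sum.mono_neutral_cong_right) auto
      then show ?thesis using tail_sums_bounded[OF \<phi>] by simp
    qed
    then obtain g :: "'a \<Rightarrow>\<^sub>L real"
      where "norm g \<le> 2 * R" "\<And>k. g (x k) = (if m \<le> k then 1 else 0)"
      using Helly_moment[of "2 * R" "\<lambda>k. if m \<le> k then 1 else 0" x] \<open>R \<ge> 0\<close> by auto
    then show ?thesis by blast
  qed
  then obtain G :: "nat \<Rightarrow> 'a \<Rightarrow>\<^sub>L real"
    where "\<And>m. norm (G m) \<le> 2 * R" "\<And>m k. G m (x k) = (if m \<le> k then 1 else 0)" by metis
  then show thesis using that x by blast
qed

section \<open>The fixed-point-free map\<close>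

lemma small_linear_perturbation_bi_lipschitz:
  fixes S :: "'a::real_normed_vector \<Rightarrow>\<^sub>L 'a"
  assumes "norm S < 1"
  shows "bi_lipschitz_on K (\<lambda>x. x + S x)"
proof -
  have "(1 - norm S) * norm (x - y) \<le> norm (x + S x - (y + S y)) \<and>
      norm (x + S x - (y + S y)) \<le> (1 + norm S) * norm (x - y)" for x y
  proof -
    have "x + S x - (y + S y) = (x - y) + S (x - y)" by (simp add: blinfun.diff_right)
    moreover have "norm (S (x - y)) \<le> norm S * norm (x - y)" by (rule norm_blinfun)
    ultimately show ?thesis
      using norm_triangle_ineq[of "x - y" "S (x - y)"] norm_diff_ineq[of "x - y" "S (x - y)"]
      by (simp add: algebra_simps)
  qed
  moreover have "1 - norm S > 0" "1 + norm S > 0"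
    using assms norm_ge_zero[of S] by linarith+
  ultimately show ?thesis unfolding bi_lipschitz_on_def by blast
qed

text \<open>On the closed convex hull \<open>G 0\<close> is constantly 1, whereas \<open>G m\<close> tends to 0 there: on a finite convex
  combination it vanishes for large \<open>m\<close>, and the uniform bound \<open>M\<close> carries this over to the closure.\<close>

lemma summing_system_no_common_value:
  fixes x :: "nat \<Rightarrow> 'a::real_normed_vector" and G :: "nat \<Rightarrow> 'a \<Rightarrow>\<^sub>L real"
  assumes M: "\<And>m. norm (G m) \<le> M" and G: "\<And>m k. G m (x k) = (if m \<le> k then 1 else 0)"
    and z: "z \<in> closure (convex hull range x)"
  shows "\<exists>m. G m z \<noteq> G (Suc m) z"
proof (rule ccontr)
  assume "\<not> ?thesis"
  then have const: "G m z = G 0 z" for m by (induction m) auto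
  have "z \<in> {z. G 0 z = 1}"
  proof -
    have "closed {z. G 0 z = 1}"
      by (intro closed_Collect_eq continuous_intros)
    moreover have "convex {z. G 0 z = 1}"
      by (auto simp: convex_def blinfun.bilinear_simps)
    moreover have "range x \<subseteq> {z. G 0 z = 1}" using G by auto
    ultimately have "closure (convex hull range x) \<subseteq> {z. G 0 z = 1}"
      by (intro closure_minimal hull_minimal)
    then show ?thesis using z by blast
  qed
  then have one: "G m z = 1" for m using const[of m] by simp
  have "M \<ge> 0" using M[of 0] norm_ge_zero order_trans by blast
  obtain y where y: "y \<in> convex hull range x" "dist y z < 1 / (M + 1)"
    using z \<open>M \<ge> 0\<close> closure_approachable by (metis add_nonneg_pos zero_less_divide_1_iff zero_less_one)
  define E where "E = {y. \<exists>N. \<forall>m\<ge>N. G m y = 0}"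
  have "convex E"
  proof (rule convexI)
    fix p q :: 'a and u v :: real assume "p \<in> E" "q \<in> E"
    then obtain N N' where "\<forall>m\<ge>N. G m p = 0" "\<forall>m\<ge>N'. G m q = 0" by (auto simp: E_def)
    then have "\<forall>m\<ge>max N N'. G m (u *\<^sub>R p + v *\<^sub>R q) = 0" by (simp add: blinfun.bilinear_simps)
    then show "u *\<^sub>R p + v *\<^sub>R q \<in> E" unfolding E_def by blast
  qed
  moreover have "x k \<in> E" for k
    unfolding E_def using G by (auto intro!: exI[of _ "Suc k"])
  ultimately have "convex hull range x \<subseteq> E" by (intro hull_minimal) auto
  then obtain m where m: "G m y = 0" using y(1) by (auto simp: E_def)
  have "1 = \<bar>G m (z - y)\<bar>" using one[of m] m by (simp add: blinfun.diff_right)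
  also have "\<dots> \<le> norm (G m) * norm (z - y)" using norm_blinfun[of "G m" "z - y"] by simp
  also have "\<dots> \<le> M * (1 / (M + 1))"
    using M[of m] y(2) \<open>M \<ge> 0\<close>
    by (intro mult_mono) (auto simp: dist_norm norm_minus_commute)
  also have "\<dots> < 1" using \<open>M \<ge> 0\<close> by simp
  finally show False by simp
qed

text \<open>The operators \<open>S n\<close> move mass from \<open>x n\<close> to \<open>x (Suc n)\<close>, and \<open>f\<close> is the identity plus their sum \<open>T\<close>. The
  fractions of mass moved decay geometrically, which makes \<open>T\<close> small in norm and yet lets every coordinate
  of a fixed point be read off as 0.\<close>

lemma not_weakly_compact_imp_no_fixed_point:
  fixes C :: "'a::banach set"
  assumes C: "closed C" "convex C" "bounded C" and nwc: "\<not> weakly_compact C"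
  obtains K and f :: "'a \<Rightarrow> 'a" where "K \<in> bounded_closed_convex_subsets C"
    and "affine_map_on K f" and "bi_lipschitz_on K f" and "f ` K \<subseteq> K"
    and "\<And>z. z \<in> K \<Longrightarrow> f z \<noteq> z"
proof -
  obtain x :: "nat \<Rightarrow> 'a" and G :: "nat \<Rightarrow> 'a \<Rightarrow>\<^sub>L real" and M
    where x: "\<And>k. x k \<in> C" and M: "\<And>m. norm (G m) \<le> M"
      and G: "\<And>m k. G m (x k) = (if m \<le> k then 1 else 0)"
    using exists_summing_system[OF assms] by blast
  obtain B where B: "\<And>p q. p \<in> C \<Longrightarrow> q \<in> C \<Longrightarrow> norm (p - q) \<le> B"
    using C(3) unfolding bounded_two_points dist_norm by blast
  have "M \<ge> 0" using M[of 0] norm_ge_zero order_trans by blast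
  have "B \<ge> 0" using B[OF x x, of 0 0] by simp
  \<comment> \<open>\<open>S n\<close> below has norm at most \<open>c * (1/2) ^ n * (2 * M * B)\<close>, and these bounds have to add up to at
    most 1/2; the summand 1 covers the case \<open>M * B = 0\<close>. Also \<open>c \<le> 1\<close> is needed, as one cannot move more than
    the available mass.\<close>
  define c where "c = 1 / (8 * M * B + 1)"
  have c: "0 < c" "c \<le> 1" "c * (2 * M * B) \<le> 1 / 4"
    using mult_nonneg_nonneg[OF \<open>M \<ge> 0\<close> \<open>B \<ge> 0\<close>]
    by (simp_all add: c_def field_simps add_nonneg_pos)
  define S where "S n = (c * (1/2) ^ n) *\<^sub>R
      (blinfun_scaleR_left (x (Suc n) - x n) o\<^sub>L (G n - G (Suc n)))" for n
  have S_apply: "S n z = (c * (1/2) ^ n * (G n z - G (Suc n) z)) *\<^sub>R (x (Suc n) - x n)" for n z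
    by (simp add: S_def blinfun.bilinear_simps)
  have S_norm: "norm (S n) \<le> 1 / 4 * (1/2) ^ n" for n
  proof (rule norm_blinfun_bound)
    fix z
    have "\<bar>G n z - G (Suc n) z\<bar> \<le> 2 * M * norm z"
    proof -
      have "\<bar>G n z\<bar> \<le> M * norm z" for n
        using norm_blinfun[of "G n" z] mult_right_mono[OF M[of n] norm_ge_zero[of z]] by simp
      from this[of n] this[of "Suc n"] show ?thesis by linarith
    qed
    then have "norm (S n z) \<le> c * (1/2) ^ n * (2 * M * norm z) * B"
      using B[OF x[of "Suc n"] x[of n]] c(1) \<open>M \<ge> 0\<close>
      unfolding S_apply norm_scaleR abs_mult by (intro mult_mono) auto
    also have "\<dots> = (c * (2 * M * B)) * ((1/2) ^ n * norm z)" by simp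
    also have "\<dots> \<le> 1 / 4 * ((1/2) ^ n * norm z)"
      by (rule mult_right_mono[OF c(3)]) simp
    finally show "norm (S n z) \<le> 1 / 4 * (1/2) ^ n * norm z" by simp
  qed simp
  have geom: "summable (\<lambda>n. 1 / 4 * (1/2) ^ n :: real)" by (intro summable_mult summable_geometric) simp
  have S_summable: "summable S"
    by (rule summable_comparison_test'[OF geom, of 0]) (use S_norm in auto)
  define T where "T = (\<Sum>n. S n)"
  have "norm T \<le> (\<Sum>n. 1 / 4 * (1/2) ^ n)"
    unfolding T_def by (rule norm_suminf_le[OF S_norm geom])
  also have "\<dots> = 1 / 2"
    using suminf_mult[OF summable_geometric[of "1/2 :: real"], of "1/4"]
    by (simp add: suminf_geometric)
  finally have T_norm: "norm T < 1" by simp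
  have T_apply: "(\<lambda>n. S n z) sums T z" for z
    using S_summable unfolding T_def
    by (intro bounded_linear.sums[OF blinfun.bounded_linear_left] summable_sums)
  define f where "f z = z + T z" for z
  define K where "K = closure (convex hull range x)"
  have T_x: "T (x k) = (c * (1/2) ^ k) *\<^sub>R (x (Suc k) - x k)" for k
  proof -
    have "S n (x k) = (if n = k then (c * (1/2) ^ k) *\<^sub>R (x (Suc k) - x k) else 0)" for n
      by (auto simp: S_apply G)
    then have "(\<lambda>n. S n (x k)) sums ((c * (1/2) ^ k) *\<^sub>R (x (Suc k) - x k))"
      using sums_single[of k "\<lambda>_. (c * (1/2) ^ k) *\<^sub>R (x (Suc k) - x k)"] by simp
    then show ?thesis using T_apply sums_unique2 by blast
  qed
  have "bounded_linear f"
    unfolding f_def by (intro bounded_linear_add bounded_linear_ident blinfun.bounded_linear_right)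
  have f_hull: "f z \<in> convex hull range x" if "z \<in> convex hull range x" for z
  proof -
    have "f (x k) \<in> convex hull range x" for k
    proof -
      define t where "t = c * (1/2) ^ k"
      have t: "0 \<le> t" "t \<le> 1"
        using c mult_mono[of c 1 "(1/2) ^ k" 1] by (auto simp: t_def power_le_one)
      have "f (x k) = (1 - t) *\<^sub>R x k + t *\<^sub>R x (Suc k)"
        by (simp add: f_def T_x t_def algebra_simps)
      also have "\<dots> \<in> convex hull range x"
        using t by (intro convexD[OF convex_convex_hull] hull_inc) auto
      finally show ?thesis .
    qed
    then have "f ` (convex hull range x) \<subseteq> convex hull range x"
      unfolding convex_hull_linear_image[OF bounded_linear.linear[OF \<open>bounded_linear f\<close>]]
      by (intro hull_minimal) auto
    then show ?thesis using that by blast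
  qed
  show thesis
  proof (rule that)
    have "K \<subseteq> C"
      unfolding K_def using x C by (intro closure_minimal hull_minimal) auto
    moreover have "K \<noteq> {}" unfolding K_def by simp
    ultimately show "K \<in> bounded_closed_convex_subsets C"
      using bounded_subset[OF C(3)]
      by (auto simp: bounded_closed_convex_subsets_def K_def convex_closure)
    show "affine_map_on K f"
      by (simp add: affine_map_on_def f_def blinfun.bilinear_simps algebra_simps)
    show "bi_lipschitz_on K f"
      unfolding f_def by (rule small_linear_perturbation_bi_lipschitz[OF T_norm])
    show "f ` K \<subseteq> K"
      unfolding K_def
    proof (rule image_closure_subset)
      show "continuous_on (closure (convex hull range x)) f"
        using \<open>bounded_linear f\<close> by (rule linear_continuous_on)
      show "f ` (convex hull range x) \<subseteq> closure (convex hull range x)"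
        using f_hull closure_subset by blast
    qed simp
    show "f z \<noteq> z" if "z \<in> K" for z
    proof
      assume "f z = z"
      then have "T z = 0" by (simp add: f_def)
      \<comment> \<open>Among the differences \<open>x (Suc n) - x n\<close>, only the one with \<open>n = m\<close> crosses the threshold of
        \<open>G (Suc m)\<close>, so this functional extracts a single coordinate from \<open>T z\<close>.\<close>
      have "G m z = G (Suc m) z" for m
      proof -
        have "(\<lambda>n. G (Suc m) (S n z)) sums G (Suc m) (T z)"
          by (rule bounded_linear.sums[OF blinfun.bounded_linear_right T_apply])
        moreover have "G (Suc m) (S n z) = (if n = m then c * (1/2) ^ m * (G m z - G (Suc m) z) else 0)" for n
          by (auto simp: S_apply blinfun.bilinear_simps G)
        ultimately have "(\<lambda>n. if n = m then c * (1/2) ^ m * (G m z - G (Suc m) z) else 0) sums 0"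
          using \<open>T z = 0\<close> by simp
        then have "c * (1/2) ^ m * (G m z - G (Suc m) z) = 0"
          using sums_single[of m "\<lambda>_. c * (1/2) ^ m * (G m z - G (Suc m) z)"] sums_unique2 by blast
        then show ?thesis using c(1) by simp
      qed
      then show False
        using summing_system_no_common_value[OF M G] that unfolding K_def by blast
    qed
  qed
qed

theorem theorem6p1:
  fixes C :: "'a::banach set"
  assumes "C \<noteq> {}" and "closed C" and "convex C" and "bounded C"
  shows "weakly_compact C \<longleftrightarrow> generic_fpp (\<lambda>K f. affine_map_on K f \<and> bi_lipschitz_on K f) C"
proof
  assume wc: "weakly_compact C"
  show "generic_fpp (\<lambda>K f. affine_map_on K f \<and> bi_lipschitz_on K f) C"
    unfolding generic_fpp_def
  proof (intro ballI allI impI)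
    fix K and f :: "'a \<Rightarrow> 'a"
    assume K: "K \<in> bounded_closed_convex_subsets C"
      and f: "(affine_map_on K f \<and> bi_lipschitz_on K f) \<and> f ` K \<subseteq> K"
    obtain b where "\<And>x y. x \<in> K \<Longrightarrow> y \<in> K \<Longrightarrow> norm (f x - f y) \<le> b * norm (x - y)" "b > 0"
      using f unfolding bi_lipschitz_on_def by blast
    then have "b-lipschitz_on K f" by (intro lipschitz_onI) (auto simp: dist_norm)
    then have "continuous_on K f" by (rule lipschitz_on_continuous_on)
    then show "\<exists>x\<in>K. f x = x"
      using weakly_compact_fixed_point[OF wc] K f by (auto simp: bounded_closed_convex_subsets_def)
  qed
next
  assume fpp: "generic_fpp (\<lambda>K f. affine_map_on K f \<and> bi_lipschitz_on K f) C"
  show "weakly_compact C"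
  proof (rule ccontr)
    assume "\<not> weakly_compact C"
    then obtain K and f :: "'a \<Rightarrow> 'a" where "K \<in> bounded_closed_convex_subsets C"
      "affine_map_on K f" "bi_lipschitz_on K f" "f ` K \<subseteq> K" "\<And>z. z \<in> K \<Longrightarrow> f z \<noteq> z"
      using not_weakly_compact_imp_no_fixed_point[OF assms(2-4)] by blast
    then show False using fpp unfolding generic_fpp_def by blast
  qed
qed

end
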